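(* Let $n\ge1$, $\delta>0$, $\beta<n+4$, and let $f\in H^s(T^n)$ (for some $s\in\mathbb{R}$) be such that $\sum_{k\in\mathbb{Z}^n}|\hat f_k|<\infty$. Let $$u(x,t)=\sum_{k\in\mathbb{Z}^n}\hat f_k\,e^{m(\nu_k)t}e^{i\nu_k\cdot x}$$ be the solution of $u_t=L^{\delta,\beta}u$ on $T^n\times(0,\infty)$, $u(\cdot,0)=f$. Then $u(x,\cdot)\in C^\infty((0,\infty))$ for all $x\in T^n$.
   Context: Let $r_1,\dots,r_n>0$ and let $T^n=\prod_{i=1}^n[0,r_i]$ be the periodic torus (opposite faces identified). For $k\in\mathbb{Z}^n$ put $\nu_k=\left(\frac{2\pi k_1}{r_1},\dots,\frac{2\pi k_n}{r_n}\right)$. A periodic distribution $h$ on $T^n$ is written through its Fourier coefficients as $h=\sum_{k\in\mathbb{Z}^n}\hat h_k e^{i\nu_k\cdot x}$. For $s\in\mathbb{R}$, $H^s(T^n)$ is the space of periodic distributions with $\|h\|_{H^s(T^n)}^2:=\sum_{k\in\mathbb{Z}^n}(1+\|k\|^2)^s|\hat h_k|^2<\infty$. For $n\ge1$, $\delta>0$, $\beta<n+4$, the Fourier multiplier is $$m(\nu)=m^{\delta,\beta}(\nu)=-\|\nu\|^2\;{}_2F_3\!\left(1,\tfrac{n+2-\beta}{2};\,2,\tfrac{n+2}{2},\tfrac{n+4-\beta}{2};\,-\tfrac14\|\nu\|^2\delta^2\right),\quad \nu\in\mathbb{R}^n.$$ For $\beta<n+2$ it equals $c^{\delta,\beta}\int_{B_\delta(0)}\frac{\cos(\nu\cdot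 z)-1}{\|z\|^\beta}dz$ with $c^{\delta,\beta}=\frac{2(n+2-\beta)\Gamma(\frac n2+1)}{\pi^{n/2}\delta^{n+2-\beta}}$; for $\beta=n+2$ it equals $-\|\nu\|^2$. The operator $L^{\delta,\beta}$ acts by $L^{\delta,\beta}J=\sum_{k}m(\nu_k)\hat J_k e^{i\nu_k\cdot x}$. Differentiability in $t$ is in the classical sense. *)

theory Defs
  imports "HOL-Analysis.Analysis"
begin

definition torus :: "real ^ 'n \<Rightarrow> (real ^ 'n) set" where
  "torus r = cbox 0 r"

definition freq :: "real ^ 'n \<Rightarrow> int ^ 'n \<Rightarrow> real ^ 'n" where
  "freq r k = (\<chi> i. 2 * pi * of_int (k $ i) / (r $ i))"

definition character :: "real ^ 'n \<Rightarrow> int ^ 'n \<Rightarrow> real ^ 'n \<Rightarrow> complex" where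
  "character r k x = exp (\<i> * of_real (freq r k \<bullet> x))"


definition partial_deriv :: "'n \<Rightarrow> (real ^ 'n \<Rightarrow> complex) \<Rightarrow> real ^ 'n \<Rightarrow> complex" where
  "partial_deriv j \<phi> x = vector_derivative (\<lambda>t. \<phi> (x + t *\<^sub>R axis j 1)) (at 0)"

definition iter_partial :: "'n list \<Rightarrow> (real ^ 'n \<Rightarrow> complex) \<Rightarrow> real ^ 'n \<Rightarrow> complex" where
  "iter_partial js \<phi> = foldr partial_deriv js \<phi>"

text \<open>Smooth periodic functions on $\mathbb{R}^n$.  Differentiability of every iterated partial
  derivative is equivalent to being $C^\infty$, since it forces all of them to be continuous.\<close>

definition test_function :: "real ^ 'n \<Rightarrow> (real ^ 'n \<Rightarrow> complex) \<Rightarrow> bool" where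
  "test_function r \<phi> \<longleftrightarrow>
     (\<forall>js. iter_partial js \<phi> differentiable_on UNIV) \<and>
     (\<forall>x i. \<phi> (x + axis i (r $ i)) = \<phi> x)"

text \<open>Continuous linear functionals on the smooth periodic functions, continuity being expressed
  through the seminorms that define the topology of that space.  The values of the functional
  outside the test functions are irrelevant.\<close>

definition periodic_distribution ::
    "real ^ 'n \<Rightarrow> ((real ^ 'n \<Rightarrow> complex) \<Rightarrow> complex) \<Rightarrow> bool" where
  "periodic_distribution r h \<longleftrightarrow>
     (\<forall>\<phi> \<psi>. test_function r \<phi> \<longrightarrow> test_function r \<psi> \<longrightarrow> h (\<lambda>x. \<phi> x + \<psi> x) = h \<phi> + h \<psi>) \<and>
     (\<forall>c \<phi>. test_function r \<phi> \<longrightarrow> h (\<lambda>x. c * \<phi> x) = c * h \<phi>) \<and>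
     (\<exists>C N. \<forall>\<phi>. test_function r \<phi> \<longrightarrow>
        cmod (h \<phi>) \<le> C * (\<Sum>js | length js \<le> N. SUP x\<in>torus r. cmod (iter_partial js \<phi> x)))"

text \<open>A locally integrable function acts by $\phi \mapsto \int_{T^n} h\phi$, so this is
  $|T^n|^{-1} \int_{T^n} h(x) e^{-i\nu_k\cdot x}\,dx$ and $h = \sum_k \hat h_k e^{i\nu_k\cdot x}$.\<close>

definition fourier_coeff ::
    "real ^ 'n \<Rightarrow> ((real ^ 'n \<Rightarrow> complex) \<Rightarrow> complex) \<Rightarrow> int ^ 'n \<Rightarrow> complex" where
  "fourier_coeff r h k = h (\<lambda>x. character r (- k) x) / of_real (\<Prod>i\<in>UNIV. r $ i)"

definition sobolev ::
    "real \<Rightarrow> real ^ 'n \<Rightarrow> ((real ^ 'n \<Rightarrow> complex) \<Rightarrow> complex) set" where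
  "sobolev s r = {h. periodic_distribution r h \<and>
     (\<lambda>k :: int ^ 'n. (1 + (norm (\<chi> i. real_of_int (k $ i)))\<^sup>2) powr s
         * (cmod (fourier_coeff r h k))\<^sup>2) summable_on UNIV}"


definition hypergeometric :: "real list \<Rightarrow> real list \<Rightarrow> real \<Rightarrow> real" where
  "hypergeometric as bs z = eval_fps (fps_hypergeo as bs 1) z"

definition multiplier :: "real \<Rightarrow> real \<Rightarrow> real ^ 'n \<Rightarrow> real" where
  "multiplier \<delta> \<beta> \<nu> = - (norm \<nu>)\<^sup>2 *
     (let n = real CARD('n) in
      hypergeometric [1, (n + 2 - \<beta>) / 2] [2, (n + 2) / 2, (n + 4 - \<beta>) / 2]
        (- (1 / 4) * (norm \<nu>)\<^sup>2 * \<delta>\<^sup>2))"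

definition nonlocal_heat_coeff ::
    "real ^ 'n \<Rightarrow> real \<Rightarrow> real \<Rightarrow> ((real ^ 'n \<Rightarrow> complex) \<Rightarrow> complex) \<Rightarrow> real \<Rightarrow> int ^ 'n \<Rightarrow> complex" where
  "nonlocal_heat_coeff r \<delta> \<beta> f t k =
     fourier_coeff r f k * of_real (exp (multiplier \<delta> \<beta> (freq r k) * t))"

definition nonlocal_heat_solution ::
    "real ^ 'n \<Rightarrow> real \<Rightarrow> real \<Rightarrow> ((real ^ 'n \<Rightarrow> complex) \<Rightarrow> complex) \<Rightarrow> real ^ 'n \<Rightarrow> real \<Rightarrow> complex" where
  "nonlocal_heat_solution r \<delta> \<beta> f x t =
     (\<Sum>\<^sub>\<infinity>k. nonlocal_heat_coeff r \<delta> \<beta> f t k * character r k x)"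

text \<open>The equation $u_t = L^{\delta,\beta} u$, $u(\cdot,0) = f$, read off on the Fourier side.\<close>

lemma nonlocal_heat_coeff_initial:
  "nonlocal_heat_coeff r \<delta> \<beta> f 0 k = fourier_coeff r f k"
  by (simp add: nonlocal_heat_coeff_def)

lemma nonlocal_heat_coeff_ode:
  "((\<lambda>t. nonlocal_heat_coeff r \<delta> \<beta> f t k) has_vector_derivative
     of_real (multiplier \<delta> \<beta> (freq r k)) * nonlocal_heat_coeff r \<delta> \<beta> f t k) (at t)"
  unfolding nonlocal_heat_coeff_def
  by (rule has_vector_derivative_eq_rhs, (rule derivative_intros)+) (auto simp: algebra_simps)


text \<open>Meant for open sets \<open>S\<close>; \<open>D j\<close> is the \<open>j\<close>-th derivative.\<close>

definition smooth_real_on :: "real set \<Rightarrow> (real \<Rightarrow> 'a :: real_normed_vector) \<Rightarrow> bool" where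
  "smooth_real_on S g \<longleftrightarrow>
     (\<exists>D :: nat \<Rightarrow> real \<Rightarrow> 'a. D 0 = g \<and>
        (\<forall>j. \<forall>t\<in>S. (D j has_vector_derivative D (Suc j) t) (at t)))"

end

theory Submission
  imports Defs
begin

text \<open>Everything rests on \<open>m \<le> 0\<close>. With \<open>a = (n + 2 - \<beta>) / 2 > -1\<close>, \<open>c = n / 2\<close> and
  \<open>y = \<parallel>\<nu>\<parallel>\<^sup>2 \<delta>\<^sup>2 / 4\<close>, the hypergeometric factor \<open>\<phi>(y)\<close> of the multiplier satisfies the Euler-type
  equation \<open>y (y \<phi>' + a \<phi>) = a c (1 - g)\<close>, where \<open>g(y) = \<^sub>0F\<^sub>1(; c; -y)\<close> is a Bessel function. Since
  \<open>1 - y / c \<le> g \<le> 1\<close>, the function \<open>y\<^sup>a \<phi>\<close> (if \<open>a > 0\<close>) or \<open>y\<^sup>a (\<phi> - 1)\<close> (if \<open>-1 < a \<le> 0\<close>) increases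
  from \<open>0\<close>, so \<open>\<phi> \<ge> 0\<close>. Given \<open>m \<le> 0\<close>, each \<open>\<bar>m\<bar>\<^sup>j e\<^sup>m\<^sup>t\<close> is bounded by \<open>j! / t\<^sup>j\<close>, and the series can
  be differentiated term by term.\<close>

section \<open>Entire power series\<close>

text \<open>Iterating the ratio bound gives \<open>\<bar>F n\<bar> \<le> \<bar>F 0\<bar> *
  \<bar>K\<bar> ^ n / n!\<close>, so an exponential series dominates at every point.\<close>

lemma fps_conv_radius_inftyI:
  fixes F :: "real fps"
  assumes "\<And>n. \<bar>fps_nth F (Suc n)\<bar> * real (Suc n) \<le> K * \<bar>fps_nth F n\<bar>"
  shows "fps_conv_radius F = \<infinity>"
  unfolding fps_conv_radius_def
proof (rule conv_radius_inftyI'')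
  fix z :: real
  have bound: "\<bar>fps_nth F n\<bar> \<le> \<bar>fps_nth F 0\<bar> * \<bar>K\<bar> ^ n / fact n" for n
  proof (induction n)
    case (Suc n)
    have "\<bar>fps_nth F (Suc n)\<bar> * real (Suc n) \<le> \<bar>K\<bar> * \<bar>fps_nth F n\<bar>"
      using assms[of n] by (meson abs_ge_self abs_ge_zero mult_right_mono order_trans)
    also have "\<dots> \<le> \<bar>K\<bar> * (\<bar>fps_nth F 0\<bar> * \<bar>K\<bar> ^ n / fact n)"
      by (intro mult_left_mono Suc.IH) auto
    finally show ?case
      by (simp add: pos_le_divide_eq mult_ac del: of_nat_Suc)
  qed simp
  have "summable (\<lambda>n. \<bar>fps_nth F 0\<bar> * ((\<bar>K\<bar> * \<bar>z\<bar>) ^ n /\<^sub>R fact n))"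
    by (intro summable_mult summable_exp_generic)
  then show "summable (\<lambda>n. fps_nth F n * z ^ n)"
  proof (rule summable_comparison_test'[where N = 0])
    fix n
    have "norm (fps_nth F n * z ^ n) \<le> (\<bar>fps_nth F 0\<bar> * \<bar>K\<bar> ^ n / fact n) * \<bar>z\<bar> ^ n"
      unfolding real_norm_def abs_mult power_abs by (intro mult_right_mono bound) auto
    then show "norm (fps_nth F n * z ^ n) \<le> \<bar>fps_nth F 0\<bar> * ((\<bar>K\<bar> * \<bar>z\<bar>) ^ n /\<^sub>R fact n)"
      by (simp add: power_mult_distrib field_simps)
  qed
qed

lemma fps_conv_radius_infty_closed:
  fixes f g :: "real fps"
  assumes "fps_conv_radius f = \<infinity>" "fps_conv_radius g = \<infinity>"
  shows "fps_conv_radius (f + g) = \<infinity>" "fps_conv_radius (f - g) = \<infinity>"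
    "fps_conv_radius (f * g) = \<infinity>"
  using fps_conv_radius_add[of f g] fps_conv_radius_diff[of f g] fps_conv_radius_mult[of f g] assms
  by simp_all

text \<open>Moves the sign of the argument into the series, so that the analysis takes place on
  \<open>y \<ge> 0\<close>.\<close>

lemma eval_fps_hypergeo_minus:
  fixes z :: real
  shows "eval_fps (fps_hypergeo as bs 1) (- z) = eval_fps (fps_hypergeo as bs (- 1)) z"
  unfolding eval_fps_def fps_hypergeo_nth
  by (intro arg_cong[where f = suminf] ext) (simp add: power_minus[of z])

section \<open>The Bessel function and its bounds\<close>

text \<open>For \<open>c > 0\<close> and \<open>y > 0\<close> the sum is
  \<open>Gamma(c) * y powr ((1 - c) / 2) * J(2 * sqrt y)\<close>, with \<open>J\<close> the Bessel
  function of the first kind of order \<open>c - 1\<close>.\<close>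

abbreviation bessel_fps :: "real \<Rightarrow> real fps" where
  "bessel_fps c \<equiv> fps_hypergeo [] [c] (- 1)"

lemma bessel_fps_Suc:
  "real (Suc n) * fps_nth (bessel_fps c) (Suc n) = - fps_nth (bessel_fps c) n / (c + real n)"
  by (simp add: pochhammer_Suc del: of_nat_Suc mult_Suc)

lemma bessel_fps_conv_radius:
  assumes "c > 0"
  shows "fps_conv_radius (bessel_fps c) = \<infinity>"
proof (rule fps_conv_radius_inftyI[where K = "1 / c"])
  fix n
  have "\<bar>fps_nth (bessel_fps c) (Suc n)\<bar> * real (Suc n) = \<bar>fps_nth (bessel_fps c) n\<bar> / (c + real n)"
    using arg_cong[OF bessel_fps_Suc[of n c], of abs] assms
    by (simp add: abs_mult mult.commute del: fps_hypergeo_nth of_nat_Suc)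
  also have "\<dots> \<le> \<bar>fps_nth (bessel_fps c) n\<bar> / c"
    using assms by (intro divide_left_mono) auto
  finally show "\<bar>fps_nth (bessel_fps c) (Suc n)\<bar> * real (Suc n) \<le> 1 / c * \<bar>fps_nth (bessel_fps c) n\<bar>"
    by (simp only: times_divide_eq_left mult_1)
qed

text \<open>Since \<open>(c)_(n+1) = c * (c+1)_n\<close>, differentiation only shifts the parameter;
  all derivatives stay in the family.\<close>

lemma fps_deriv_bessel:
  assumes "c > 0"
  shows "fps_deriv (bessel_fps c) = fps_const (- 1 / c) * bessel_fps (c + 1)"
proof (rule fps_ext)
  fix n
  show "fps_nth (fps_deriv (bessel_fps c)) n = fps_nth (fps_const (- 1 / c) * bessel_fps (c + 1)) n"
    using assms by (simp add: pochhammer_rec del: of_nat_Suc mult_Suc)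
qed

lemma bessel_fps_ode:
  assumes "c > 0"
  shows "fps_X * fps_deriv (fps_deriv (bessel_fps c)) + fps_const c * fps_deriv (bessel_fps c)
    + bessel_fps c = 0"
    (is "?L = 0")
proof (rule fps_ext)
  fix n
  have "fps_nth ?L n = (c + real n) * (real (Suc n) * fps_nth (bessel_fps c) (Suc n))
      + fps_nth (bessel_fps c) n"
    by (cases n) (simp_all add: algebra_simps del: fps_hypergeo_nth)
  also have "\<dots> = 0"
    unfolding bessel_fps_Suc using assms by (simp add: add_pos_nonneg less_imp_neq[symmetric])
  finally show "fps_nth ?L n = fps_nth 0 n" by simp
qed

definition bessel :: "real \<Rightarrow> real \<Rightarrow> real" where
  "bessel c y = eval_fps (bessel_fps c) y"

lemma bessel_0 [simp]: "bessel c 0 = 1"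
  by (simp add: bessel_def eval_fps_at_0)

lemma has_derivative_bessel:
  assumes "c > 0"
  shows "(bessel c has_real_derivative - (1 / c) * bessel (c + 1) y) (at y)"
proof -
  have "(eval_fps (bessel_fps c) has_real_derivative eval_fps (fps_deriv (bessel_fps c)) y) (at y)"
    by (rule has_field_derivative_eval_fps) (simp add: bessel_fps_conv_radius assms)
  also have "eval_fps (fps_deriv (bessel_fps c)) y = - (1 / c) * bessel (c + 1) y"
    using assms by (simp add: fps_deriv_bessel eval_fps_mult bessel_fps_conv_radius bessel_def)
  finally show ?thesis
    unfolding bessel_def[abs_def] by simp
qed

text \<open>The equation \<open>y g'' + c g' + g = 0\<close> with both derivatives rewritten by
  parameter shifts.\<close>

lemma bessel_ode:
  assumes "c > 0"
  shows "y * bessel (c + 2) y / (c * (c + 1)) - bessel (c + 1) y + bessel c y = 0"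
proof -
  have "fps_X * (fps_const (- 1 / c) * (fps_const (- 1 / (c + 1)) * bessel_fps (c + 2)))
      + fps_const c * (fps_const (- 1 / c) * bessel_fps (c + 1)) + bessel_fps c = 0"
    using bessel_fps_ode[OF assms] assms by (simp add: fps_deriv_bessel add.assoc)
  from arg_cong[OF this, of "\<lambda>F. eval_fps F y"]
  have "y * (- 1 / c * (- 1 / (c + 1) * bessel (c + 2) y)) + c * (- 1 / c * bessel (c + 1) y)
      + bessel c y = 0"
    using assms
    by (simp only: eval_fps_add eval_fps_mult eval_fps_X eval_fps_const eval_fps_0 bessel_def
        fps_conv_radius_infty_closed bessel_fps_conv_radius fps_conv_radius_const
        fps_conv_radius_fps_X add_pos_pos zero_less_one zero_less_numeral ereal_less(3) less_ereal.simps)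
  then show ?thesis using assms by simp
qed

lemma bessel_le_1:
  assumes c: "c \<ge> 1 / 2" and y: "y \<ge> 0"
  shows "bessel c y \<le> 1"
proof -
  \<comment> \<open>Energy of the Bessel equation \<open>y g'' + c g' + g = 0\<close>: \<open>E = g\<^sup>2 + y g'\<^sup>2\<close> has derivative \<open>(1 - 2 c) g'\<^sup>2\<close>.\<close>
  define E where "E = (\<lambda>y. (bessel c y)\<^sup>2 + y * (bessel (c + 1) y / c)\<^sup>2)"
  have "E y \<le> E 0"
  proof (rule DERIV_nonpos_imp_nonincreasing[OF y])
    fix x :: real
    have "c \<noteq> 0" "c + 1 \<noteq> 0" using c by auto
    have "(E has_real_derivative 2 * bessel c x * (- (1 / c) * bessel (c + 1) x)
        + ((bessel (c + 1) x / c)\<^sup>2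
          + x * (2 * (bessel (c + 1) x / c) * (- (1 / (c + 1)) * bessel (c + 2) x / c)))) (at x)"
      unfolding E_def using c
      by (auto intro!: derivative_eq_intros has_derivative_bessel[THEN DERIV_cong]
          simp: add.assoc mult_ac)
    also have "2 * bessel c x * (- (1 / c) * bessel (c + 1) x)
        + ((bessel (c + 1) x / c)\<^sup>2
          + x * (2 * (bessel (c + 1) x / c) * (- (1 / (c + 1)) * bessel (c + 2) x / c)))
      = (bessel (c + 1) x / c)\<^sup>2 - 2 * (bessel (c + 1) x / c)
          * (x * bessel (c + 2) x / (c * (c + 1)) + bessel c x)"
      using \<open>c \<noteq> 0\<close> \<open>c + 1 \<noteq> 0\<close> by (simp add: divide_simps power2_eq_square) (simp add: algebra_simps)
    also have "x * bessel (c + 2) x / (c * (c + 1)) + bessel c x = bessel (c + 1) x"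
      using bessel_ode[of c x] c by simp
    also have "(bessel (c + 1) x / c)\<^sup>2 - 2 * (bessel (c + 1) x / c) * bessel (c + 1) x
        = (1 - 2 * c) * (bessel (c + 1) x / c)\<^sup>2"
      using \<open>c \<noteq> 0\<close> by (simp add: field_simps power2_eq_square)
    finally have "(E has_real_derivative (1 - 2 * c) * (bessel (c + 1) x / c)\<^sup>2) (at x)" .
    \<comment> \<open>With \<open>c = n / 2\<close>, the threshold \<open>c \<ge> 1 / 2\<close> is
      dimension at least one.\<close>
    moreover have "(1 - 2 * c) * (bessel (c + 1) x / c)\<^sup>2 \<le> 0"
      using c by (intro mult_nonpos_nonneg) auto
    ultimately show "\<exists>d. (E has_real_derivative d) (at x) \<and> d \<le> 0"
      by blast
  qed
  then have "(bessel c y)\<^sup>2 \<le> 1\<^sup>2"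
    using y by (simp add: E_def) (smt (verit) mult_nonneg_nonneg zero_le_power2)
  then show ?thesis
    using abs_le_square_iff[of "bessel c y" 1] by simp
qed

text \<open>The upper bound at parameter \<open>c + 1\<close> says \<open>g' \<ge> - 1 / c\<close>,
  so \<open>g + y / c\<close> increases from its value 1 at 0.\<close>

lemma bessel_ge_linear:
  assumes c: "c \<ge> 1 / 2" and y: "y \<ge> 0"
  shows "bessel c y \<ge> 1 - y / c"
proof -
  have "bessel c 0 + 0 / c \<le> bessel c y + y / c"
  proof (rule DERIV_nonneg_imp_nondecreasing[OF y])
    fix x :: real
    assume "0 \<le> x"
    have "((\<lambda>y. bessel c y + y / c) has_real_derivative (- (1 / c) * bessel (c + 1) x + 1 / c)) (at x)"
      using c by (auto intro!: derivative_eq_intros has_derivative_bessel[THEN DERIV_cong])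
    moreover have "- (1 / c) * bessel (c + 1) x + 1 / c \<ge> 0"
      using bessel_le_1[of "c + 1" x] c \<open>0 \<le> x\<close> by (simp add: field_simps)
    ultimately show "\<exists>d. ((\<lambda>y. bessel c y + y / c) has_real_derivative d) (at x) \<and> 0 \<le> d"
      by blast
  qed
  then show ?thesis by simp
qed

section \<open>Sign of the multiplier\<close>

text \<open>Integrating factor: \<open>x powr a * q x\<close> has derivative
  \<open>x powr (a - 1) * (x * q' x + a * q x)\<close>, so it increases from its limit 0. A limit
  replaces the value at 0 because \<open>a\<close> may be negative.\<close>

lemma nonneg_if_euler_nonneg:
  fixes q q' :: "real \<Rightarrow> real"
  assumes deriv: "\<And>x. x > 0 \<Longrightarrow> (q has_real_derivative q' x) (at x)"
    and ineq: "\<And>x. x > 0 \<Longrightarrow> x * q' x + a * q x \<ge> 0"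
    and lim: "((\<lambda>x. x powr a * q x) \<longlongrightarrow> 0) (at_right 0)"
    and y: "y > 0"
  shows "q y \<ge> 0"
proof -
  have mono: "x powr a * q x \<le> y powr a * q y" if "0 < x" "x \<le> y" for x
  proof (rule DERIV_nonneg_imp_nondecreasing[OF \<open>x \<le> y\<close>])
    fix z assume "x \<le> z"
    then have z: "z > 0" using that by simp
    have "((\<lambda>x. x powr a * q x) has_real_derivative
        z powr (a - 1) * (z * q' z + a * q z)) (at z)"
      using z by (auto intro!: derivative_eq_intros deriv simp: powr_diff field_simps)
    moreover have "z powr (a - 1) * (z * q' z + a * q z) \<ge> 0"
      using ineq[OF z] by simp
    ultimately show "\<exists>d. ((\<lambda>x. x powr a * q x) has_real_derivative d) (at z) \<and> 0 \<le> d"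
      by blast
  qed
  have "eventually (\<lambda>x. x powr a * q x \<le> y powr a * q y) (at_right 0)"
    using eventually_at_right_less[of 0] eventually_at_right_field[of _ 0]
    by (metis (mono_tags, lifting) mono less_eq_real_def y)
  then have "0 \<le> y powr a * q y"
    by (rule tendsto_upperbound[OF lim]) simp
  then show ?thesis
    using y by (simp add: zero_le_mult_iff)
qed

lemma multiplier_fps_conv_radius:
  assumes "a > - 1" "b > 0"
  shows "fps_conv_radius (fps_hypergeo [1, a] [2, b, a + 1] (- 1 :: real)) = \<infinity>"
    (is "fps_conv_radius ?F = _")
proof (rule fps_conv_radius_inftyI[where K = "(1 + 1 / (a + 1)) / b"])
  fix n
  let ?x = "real n"
  have ratio: "fps_nth ?F (Suc n) * real (Suc n) =
      - ((1 + ?x) / (2 + ?x) * ((a + ?x) / (a + 1 + ?x)) / (b + ?x)) * fps_nth ?F n"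
    by (simp add: fps_hypergeo_rec del: fps_hypergeo_nth) (simp add: divide_simps, simp add: algebra_simps)
  have 1: "(1 + ?x) / (2 + ?x) \<le> 1" "(1 + ?x) / (2 + ?x) \<ge> 0" by (auto simp: field_simps)
  \<comment> \<open>For \<open>a\<close> close to -1 the quotient at \<open>n = 0\<close> is large
    and negative, hence the term \<open>1 / (a + 1)\<close> in \<open>K\<close>.\<close>
  have 2: "\<bar>(a + ?x) / (a + 1 + ?x)\<bar> \<le> 1 + 1 / (a + 1)"
  proof -
    have "(a + ?x) / (a + 1 + ?x) = 1 - 1 / (a + 1 + ?x)" using assms by (simp add: field_simps)
    moreover have "1 / (a + 1 + ?x) \<le> 1 / (a + 1)" using assms by (intro divide_left_mono) auto
    moreover have "1 / (a + 1 + ?x) > 0" using assms by simp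
    ultimately show ?thesis by linarith
  qed
  have "\<bar>(1 + ?x) / (2 + ?x) * ((a + ?x) / (a + 1 + ?x)) / (b + ?x)\<bar>
      = (1 + ?x) / (2 + ?x) * \<bar>(a + ?x) / (a + 1 + ?x)\<bar> / (b + ?x)"
    using assms 1 by (simp add: abs_mult)
  also have "\<dots> \<le> 1 * (1 + 1 / (a + 1)) / b"
    using assms 1 2 by (intro frac_le mult_mono mult_nonneg_nonneg) auto
  finally have 3: "\<bar>(1 + ?x) / (2 + ?x) * ((a + ?x) / (a + 1 + ?x)) / (b + ?x)\<bar> \<le> (1 + 1 / (a + 1)) / b"
    by simp
  have "\<bar>fps_nth ?F (Suc n)\<bar> * real (Suc n) = \<bar>fps_nth ?F (Suc n) * real (Suc n)\<bar>"
    by (simp only: abs_mult abs_of_nat)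
  also have "\<dots> = \<bar>(1 + ?x) / (2 + ?x) * ((a + ?x) / (a + 1 + ?x)) / (b + ?x)\<bar> * \<bar>fps_nth ?F n\<bar>"
    unfolding ratio by (simp only: abs_mult abs_minus_cancel)
  also have "\<dots> \<le> (1 + 1 / (a + 1)) / b * \<bar>fps_nth ?F n\<bar>"
    by (intro mult_right_mono 3) simp
  finally show "\<bar>fps_nth ?F (Suc n)\<bar> * real (Suc n) \<le> (1 + 1 / (a + 1)) / b * \<bar>fps_nth ?F n\<bar>" .
qed

text \<open>The operator \<open>y d/dy + a\<close> multiplies the n-th coefficient by
  \<open>a + n\<close>, which collapses \<open>(a)_n / (a+1)_n\<close> to \<open>a\<close>. As
  \<open>(1)_n / (2)_n = 1 / (n+1)\<close>, the factor \<open>1 / n!\<close> becomes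
  \<open>1 / (n+1)!\<close>, and multiplying by \<open>y\<close> aligns the rest with the Bessel
  series without its constant term.\<close>

lemma multiplier_fps_bessel:
  assumes "a > - 1" "c > 0"
  defines "F \<equiv> fps_hypergeo [1, a] [2, c + 1, a + 1] (- 1)"
  shows "fps_X * (fps_X * fps_deriv F + fps_const a * F) = fps_const (a * c) * (1 - bessel_fps c)"
proof (rule fps_ext)
  fix n
  show "fps_nth (fps_X * (fps_X * fps_deriv F + fps_const a * F)) n
      = fps_nth (fps_const (a * c) * (1 - bessel_fps c)) n"
  proof (cases n)
    case (Suc m)
    have p: "pochhammer (c + 1) m > 0" "pochhammer (a + 1) m > 0"
      using assms by (auto intro!: pochhammer_pos)
    have 2: "pochhammer (2 :: real) m = fact (Suc m)"
      using pochhammer_rec[of "1 :: real" m] by (simp add: pochhammer_fact[symmetric] del: fact_Suc)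
    have "fps_nth (fps_X * (fps_X * fps_deriv F + fps_const a * F)) n = (a + real m) * fps_nth F m"
      by (cases m) (simp_all add: Suc distrib_right mult.assoc)
    also have "\<dots> = (- 1) ^ m * ((a + real m) * pochhammer a m)
        / (fact (Suc m) * pochhammer (c + 1) m * pochhammer (a + 1) m)"
      by (simp add: F_def 2 pochhammer_fact[symmetric] mult_ac)
    also have "(a + real m) * pochhammer a m = a * pochhammer (a + 1) m"
      by (metis pochhammer_rec pochhammer_Suc mult.commute)
    also have "(- 1) ^ m * (a * pochhammer (a + 1) m)
        / (fact (Suc m) * pochhammer (c + 1) m * pochhammer (a + 1) m)
      = fps_nth (fps_const (a * c) * (1 - bessel_fps c)) n"
      using p assms by (simp add: Suc pochhammer_rec field_simps del: fact_Suc)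
    finally show ?thesis .
  qed simp
qed

lemma multiplier_hypergeometric_nonneg:
  assumes a: "a > - 1" and c: "c \<ge> 1 / 2" and y: "y \<ge> 0"
  shows "hypergeometric [1, a] [2, c + 1, a + 1] (- y) \<ge> 0"
proof -
  define F where "F = fps_hypergeo [1, a] [2, c + 1, a + 1] (- 1)"
  define \<phi> where "\<phi> = eval_fps F"
  define \<phi>' where "\<phi>' = eval_fps (fps_deriv F)"
  have r: "fps_conv_radius F = \<infinity>"
    unfolding F_def using a c by (intro multiplier_fps_conv_radius) auto
  have r': "fps_conv_radius (fps_deriv F) = \<infinity>"
    using fps_conv_radius_deriv[of F] r by simp
  have \<phi>0: "\<phi> 0 = 1" by (simp add: \<phi>_def F_def eval_fps_at_0)
  have deriv: "(\<phi> has_real_derivative \<phi>' x) (at x within A)" for x A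
    unfolding \<phi>_def \<phi>'_def by (rule has_field_derivative_eval_fps) (simp add: r)
  have eq: "x * (x * \<phi>' x + a * \<phi> x) = a * c * (1 - bessel c x)" for x
  proof -
    have "fps_X * (fps_X * fps_deriv F + fps_const a * F) = fps_const (a * c) * (1 - bessel_fps c)"
      unfolding F_def using a c by (intro multiplier_fps_bessel) auto
    from arg_cong[OF this, of "\<lambda>F. eval_fps F x"] show ?thesis
      using c by (simp add: eval_fps_mult eval_fps_add eval_fps_diff fps_conv_radius_infty_closed
          r r' bessel_fps_conv_radius \<phi>_def \<phi>'_def bessel_def)
  qed
  have "\<phi> y \<ge> 0" if "y > 0"
  proof (cases "a > 0")
    case True
    show ?thesis
    proof (rule nonneg_if_euler_nonneg[where q = \<phi> and a = a, OF deriv _ _ \<open>y > 0\<close>])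
      fix x :: real assume "x > 0"
      have "x * (x * \<phi>' x + a * \<phi> x) \<ge> 0"
        unfolding eq using True c \<open>x > 0\<close> bessel_le_1[of c x] by simp
      then show "x * \<phi>' x + a * \<phi> x \<ge> 0"
        using \<open>x > 0\<close> by (simp add: zero_le_mult_iff)
    next
      have "((\<lambda>x. x powr a * \<phi> x) \<longlongrightarrow> 0 powr a * \<phi> 0) (at_right 0)"
        using True DERIV_continuous[OF deriv[of 0 "{0<..}"]]
        by (intro tendsto_intros tendsto_powr')
           (auto simp: continuous_within eventually_at_filter)
      then show "((\<lambda>x. x powr a * \<phi> x) \<longlongrightarrow> 0) (at_right 0)" by simp
    qed
  next
    \<comment> \<open>Here \<open>x powr a * \<phi> x\<close> does not tend to 0, as
      \<open>\<phi> 0 = 1\<close>. Subtracting 1 turns the right side of the Euler equation into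
      \<open>a * (c * (1 - g) - x)\<close>, a product of two nonpositive factors by the linear lower
      bound on \<open>g\<close>.\<close>
    case False
    have "\<phi> y - 1 \<ge> 0"
    proof (rule nonneg_if_euler_nonneg[where q = "\<lambda>x. \<phi> x - 1" and q' = \<phi>' and a = a, OF _ _ _ \<open>y > 0\<close>])
      fix x :: real assume "x > 0"
      show "((\<lambda>x. \<phi> x - 1) has_real_derivative \<phi>' x) (at x)"
        using deriv by (auto intro!: derivative_eq_intros)
      have "x * (x * \<phi>' x + a * (\<phi> x - 1)) = a * (c * (1 - bessel c x) - x)"
        using eq[of x] by (simp add: algebra_simps)
      also have "\<dots> \<ge> 0"
        using False c \<open>x > 0\<close> bessel_ge_linear[of c x]
        by (intro mult_nonpos_nonpos) (auto simp: field_simps)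
      finally show "x * \<phi>' x + a * (\<phi> x - 1) \<ge> 0"
        using \<open>x > 0\<close> by (simp add: zero_le_mult_iff)
    next
      \<comment> \<open>One power of \<open>x\<close> is traded for the difference quotient, leaving
        the exponent \<open>a + 1 > 0\<close>.\<close>
      have "((\<lambda>x. (\<phi> x - 1) / x) \<longlongrightarrow> \<phi>' 0) (at_right 0)"
        using deriv[of 0 "{0<..}"] \<phi>0 by (simp add: has_field_derivative_iff)
      then have "((\<lambda>x. x powr (a + 1) * ((\<phi> x - 1) / x)) \<longlongrightarrow> 0 powr (a + 1) * \<phi>' 0) (at_right 0)"
        using a by (intro tendsto_intros tendsto_powr') (auto simp: eventually_at_filter)
      then have "((\<lambda>x. x powr (a + 1) * ((\<phi> x - 1) / x)) \<longlongrightarrow> 0) (at_right 0)" by simp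
      then show "((\<lambda>x. x powr a * (\<phi> x - 1)) \<longlongrightarrow> 0) (at_right 0)"
        by (rule Lim_transform_eventually) (auto simp: eventually_at_filter powr_add)
    qed
    then show ?thesis by simp
  qed
  moreover have "\<phi> y = hypergeometric [1, a] [2, c + 1, a + 1] (- y)"
    by (simp add: hypergeometric_def \<phi>_def F_def eval_fps_hypergeo_minus)
  ultimately show ?thesis using y \<phi>0 by (cases "y = 0") auto
qed

text \<open>With \<open>a = (n + 2 - \<beta>) / 2\<close> and \<open>c = n / 2\<close>, the
  condition \<open>a > - 1\<close> is \<open>\<beta> < n + 4\<close>.\<close>

lemma multiplier_nonpos:
  fixes \<nu> :: "real ^ 'n"
  assumes "\<beta> < real CARD('n) + 4"
  shows "multiplier \<delta> \<beta> \<nu> \<le> 0"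
proof -
  let ?n = "real CARD('n)"
  have "?n \<ge> 1" by (simp add: Suc_leI)
  then have "hypergeometric [1, (?n + 2 - \<beta>) / 2] [2, ?n / 2 + 1, (?n + 2 - \<beta>) / 2 + 1]
      (- (1 / 4 * (norm \<nu>)\<^sup>2 * \<delta>\<^sup>2)) \<ge> 0"
    using assms by (intro multiplier_hypergeometric_nonneg) auto
  moreover have "(?n + 2 - \<beta>) / 2 + 1 = (?n + 4 - \<beta>) / 2" "?n / 2 + 1 = (?n + 2) / 2"
    by (auto simp: field_simps)
  ultimately show ?thesis
    by (simp add: multiplier_def Let_def)
qed

section \<open>Termwise differentiation of the exponential series\<close>

lemma power_le_fact_mult_exp:
  fixes x :: real
  assumes "x \<ge> 0"
  shows "x ^ j \<le> fact j * exp x"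
proof -
  have "(\<Sum>n\<in>{j}. x ^ n /\<^sub>R fact n) \<le> exp x"
    unfolding exp_def using assms by (intro sum_le_suminf summable_exp_generic) auto
  then show ?thesis by (simp add: field_simps)
qed

text \<open>The bound does not depend on \<open>m\<close>; applied to all frequencies at once, it
  makes summability of the coefficients enough for every derivative.\<close>

lemma power_mult_exp_bound:
  fixes m t :: real
  assumes "m \<le> 0" "t > 0"
  shows "\<bar>m ^ j * exp (m * t)\<bar> \<le> fact j / t ^ j"
proof -
  have "(- m * t) ^ j \<le> fact j * exp (- m * t)"
    using assms by (intro power_le_fact_mult_exp) (simp add: mult_nonpos_nonneg)
  moreover have "\<bar>m ^ j * exp (m * t)\<bar> = (- m * t) ^ j * exp (m * t) / t ^ j"
    unfolding power_mult_distrib[of "- m"] using assms by (simp add: abs_mult power_abs)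
  ultimately show ?thesis
    using assms by (simp add: exp_minus divide_right_mono field_simps)
qed

text \<open>Second-order Taylor remainder of \<open>m ^ j * exp (m * t)\<close>, uniform in
  \<open>m\<close>.\<close>

lemma exp_taylor_bound:
  fixes m t h :: real
  assumes m: "m \<le> 0" and t: "t > 0" and h: "\<bar>h\<bar> \<le> t / 2"
  shows "\<bar>m ^ j * exp (m * (t + h)) - m ^ j * exp (m * t) - h * (m ^ Suc j * exp (m * t))\<bar>
    \<le> fact (j + 2) / (t / 2) ^ (j + 2) * h\<^sup>2"
proof -
  have "norm (exp (m * h) - (\<Sum>i\<le>1. (m * h) ^ i / fact i))
      \<le> exp (norm (m * h)) * (norm (m * h) ^ Suc 1) / fact 1"
    by (rule Taylor_exp_field)
  then have taylor: "\<bar>exp (m * h) - 1 - m * h\<bar> \<le> exp \<bar>m * h\<bar> * (m * h)\<^sup>2"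
    by (simp add: power2_eq_square abs_mult algebra_simps)
  have "\<bar>m ^ j * exp (m * (t + h)) - m ^ j * exp (m * t) - h * (m ^ Suc j * exp (m * t))\<bar>
      = \<bar>m ^ j * exp (m * t)\<bar> * \<bar>exp (m * h) - 1 - m * h\<bar>"
    unfolding abs_mult[symmetric] by (simp add: exp_add algebra_simps)
  also have "\<dots> \<le> \<bar>m ^ j * exp (m * t)\<bar> * (exp \<bar>m * h\<bar> * (m * h)\<^sup>2)"
    by (intro mult_left_mono taylor) simp
  also have "\<dots> = \<bar>m ^ (j + 2)\<bar> * exp (m * t + \<bar>m * h\<bar>) * h\<^sup>2"
    by (simp add: abs_mult exp_add power_mult_distrib power_add power2_eq_square)
  \<comment> \<open>Half of the decay \<open>exp (m * t)\<close> pays for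
    \<open>exp \<bar>m * h\<bar>\<close>; the other half then absorbs
    \<open>m ^ (j + 2)\<close>.\<close>
  also have "\<dots> \<le> \<bar>m ^ (j + 2)\<bar> * exp (m * (t / 2)) * h\<^sup>2"
  proof -
    have "\<bar>m * h\<bar> \<le> - m * (t / 2)"
      unfolding abs_mult using m h by (intro mult_mono) auto
    then have "m * t + \<bar>m * h\<bar> \<le> m * (t / 2)" by (simp add: algebra_simps)
    then show ?thesis by (intro mult_right_mono mult_left_mono) auto
  qed
  also have "\<dots> \<le> fact (j + 2) / (t / 2) ^ (j + 2) * h\<^sup>2"
    using power_mult_exp_bound[of m "t / 2" "j + 2"] m t
    by (intro mult_right_mono) (auto simp: abs_mult)
  finally show ?thesis .
qed

text \<open>The derivatives are the termwise differentiated series. Summing the uniform Taylor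
  remainders gives an error of order \<open>h\<^sup>2\<close>, which yields differentiability
  directly.\<close>

lemma smooth_exp_series:
  fixes a :: "'k \<Rightarrow> complex" and m :: "'k \<Rightarrow> real"
  assumes summable: "(\<lambda>k. cmod (a k)) summable_on UNIV" and m: "\<And>k. m k \<le> 0"
  shows "smooth_real_on {0<..} (\<lambda>t. \<Sum>\<^sub>\<infinity>k. a k * of_real (exp (m k * t)))"
  unfolding smooth_real_on_def
proof (intro exI conjI allI ballI)
  let ?w = "\<lambda>j t k. m k ^ j * exp (m k * t)"
  let ?D = "\<lambda>j t. \<Sum>\<^sub>\<infinity>k. a k * of_real (?w j t k)"
  show "?D 0 = (\<lambda>t. \<Sum>\<^sub>\<infinity>k. a k * of_real (exp (m k * t)))"
    by simp
  have summ: "(\<lambda>k. a k * of_real (?w j t k)) summable_on UNIV" if "t > 0" for j t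
  proof (rule abs_summable_summable)
    have "(\<lambda>k. cmod (a k) * (fact j / t ^ j)) summable_on UNIV"
      by (intro summable_on_cmult_left summable)
    then show "(\<lambda>k. norm (a k * of_real (?w j t k))) summable_on UNIV"
    proof (rule summable_on_comparison_test)
      fix k
      show "norm (a k * of_real (?w j t k)) \<le> cmod (a k) * (fact j / t ^ j)"
        unfolding norm_mult norm_of_real
        by (intro mult_left_mono power_mult_exp_bound m that) simp
    qed simp
  qed
  fix j and t :: real
  assume "t \<in> {0<..}"
  then have t: "t > 0" by simp
  \<comment> \<open>Depends on \<open>j\<close> and \<open>t\<close> but not on the increment
    \<open>h\<close>.\<close>
  define C where "C = (\<Sum>\<^sub>\<infinity>k. cmod (a k) * (fact (j + 2) / (t / 2) ^ (j + 2)))"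
  have bound: "cmod (?D j (t + h) - ?D j t - h *\<^sub>R ?D (Suc j) t) \<le> C * h\<^sup>2"
    if h: "\<bar>h\<bar> \<le> t / 2" for h
  proof -
    have "t + h > 0" using h t by linarith
    then have *: "((\<lambda>k. a k * of_real (?w j (t + h) k) - a k * of_real (?w j t k)
        - h *\<^sub>R (a k * of_real (?w (Suc j) t k)))
      has_sum (?D j (t + h) - ?D j t - h *\<^sub>R ?D (Suc j) t)) UNIV"
      using t unfolding diff_conv_add_uminus
      by (intro has_sum_add has_sum_uminusI has_sum_scaleR has_sum_infsum summ)
    have "((\<lambda>k. cmod (a k) * (fact (j + 2) / (t / 2) ^ (j + 2)) * h\<^sup>2) has_sum C * h\<^sup>2) UNIV"
      unfolding C_def by (intro has_sum_cmult_left has_sum_infsum summable_on_cmult_left summable)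
    with * show ?thesis
    proof (rule norm_infsum_le)
      fix k
      have "a k * of_real (?w j (t + h) k) - a k * of_real (?w j t k)
          - h *\<^sub>R (a k * of_real (?w (Suc j) t k))
        = a k * of_real (?w j (t + h) k - ?w j t k - h * ?w (Suc j) t k)"
        by (simp add: scaleR_conv_of_real algebra_simps)
      then show "cmod (a k * of_real (?w j (t + h) k) - a k * of_real (?w j t k)
          - h *\<^sub>R (a k * of_real (?w (Suc j) t k)))
        \<le> cmod (a k) * (fact (j + 2) / (t / 2) ^ (j + 2)) * h\<^sup>2"
        using exp_taylor_bound[OF m[of k] t h, of j]
        by (simp only: norm_mult norm_of_real mult.assoc mult_left_mono norm_ge_zero)
    qed
  qed
  show "(?D j has_vector_derivative ?D (Suc j) t) (at t)"
    unfolding has_vector_derivative_def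
  proof (rule has_derivativeI_sandwich[where e = "t / 2" and H = "\<lambda>x. C * \<bar>x - t\<bar>"])
    show "((\<lambda>x. C * \<bar>x - t\<bar>) \<longlongrightarrow> 0) (at t)"
      by (auto intro!: tendsto_eq_intros)
  next
    fix x assume "x \<noteq> t" "dist x t < t / 2"
    then have "cmod (?D j x - ?D j t - (x - t) *\<^sub>R ?D (Suc j) t) \<le> C * \<bar>x - t\<bar> * \<bar>x - t\<bar>"
      using bound[of "x - t"] by (simp add: dist_real_def power2_eq_square mult.assoc)
    then show "norm ((?D j x - ?D j t) - (x - t) *\<^sub>R ?D (Suc j) t) / norm (x - t) \<le> C * \<bar>x - t\<bar>"
      using \<open>x \<noteq> t\<close> by (simp add: divide_le_eq)
  qed (use t in \<open>auto intro: bounded_linear_scaleR_left\<close>)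
qed

theorem proposition2:
  fixes r :: "real ^ 'n"
    and \<delta> \<beta> s :: real
    and f :: "(real ^ 'n \<Rightarrow> complex) \<Rightarrow> complex"
  assumes "\<forall>i. r $ i > 0"
    and "\<delta> > 0"
    and "\<beta> < real CARD('n) + 4"
    and "f \<in> sobolev s r"
    and "(\<lambda>k. cmod (fourier_coeff r f k)) summable_on UNIV"
  shows "\<forall>x\<in>torus r. smooth_real_on {0<..} (nonlocal_heat_solution r \<delta> \<beta> f x)"
proof
  fix x assume "x \<in> torus r"
  \<comment> \<open>For fixed \<open>x\<close> the unimodular character is absorbed into the
    coefficients.\<close>
  have "cmod (fourier_coeff r f k * character r k x) = cmod (fourier_coeff r f k)" for k
    by (simp add: norm_mult character_def)
  then have "smooth_real_on {0<..} (\<lambda>t. \<Sum>\<^sub>\<infinity>k. fourier_coeff r f k * character r k x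
      * of_real (exp (multiplier \<delta> \<beta> (freq r k) * t)))"
    using assms by (intro smooth_exp_series multiplier_nonpos) auto
  moreover have "nonlocal_heat_solution r \<delta> \<beta> f x = (\<lambda>t. \<Sum>\<^sub>\<infinity>k. fourier_coeff r f k * character r k x
      * of_real (exp (multiplier \<delta> \<beta> (freq r k) * t)))"
    by (simp add: fun_eq_iff nonlocal_heat_solution_def nonlocal_heat_coeff_def mult_ac)
  ultimately show "smooth_real_on {0<..} (nonlocal_heat_solution r \<delta> \<beta> f x)"
    by simp
qed

end
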